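(* Let $p\ge3$ be a prime, $q\ge1$ an integer, $\theta=p^N$ with $N\ge1$. Let $|q|_p<1$ and $|\theta|_p\le|q|_p^2$. Let $V$ be the vertex set of the semi-infinite Cayley tree $\Gamma^2_+$ of order two with root $(0)$. Assume that $\{h_x\}_{x\in V\setminus\{(0)\}}$, $h_x\in\mathbb{Q}_p$, is a solution of $$h_x=g(h_{(x,1)})\,g(h_{(x,2)})\quad\text{for all }x\in V\setminus\{(0)\},\qquad g(t)=\frac{\theta t+q}{t+\theta+q-1},$$ such that $|h_x|_p\ne1$ for all $x\in V\setminus\{(0)\}$. Then $h_x=x_1$ for every $x\in V\setminus\{(0)\}$.
   Context: $\Gamma^2_+$ is the infinite rooted tree in which every vertex $x$ has exactly two direct successors, denoted $(x,1)$ and $(x,2)$. $|\cdot|_p$ is the $p$-adic absolute value. $x_1\in\mathbb{Q}_p$ is the root of $x^2+(2\theta-\theta^2+2q-1)x+q^2=0$ with $|x_1|_p=|q|_p^2$ (the other root has absolute value $1$; both exist in $\mathbb{Q}_p$ under these hypotheses); it is a fixed point of $f(x)=g(x)^2$. The displayed recursion is the restriction of the compatibility equation for $p$-adic quasi Gibbs measures of the $(q+1)$-state Potts model to the invariant line of boundary vectors $(\hat h_1,\dots,\hat h_q)=(1,\dots,1,h,1,\dots,1)$. *)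

theory Defs
  imports Complex_Main "Berlekamp_Zassenhaus.Finite_Field"
begin

section \<open>The $p$-adic absolute value on the rationals\<close>

definition padic_abs :: "nat \<Rightarrow> rat \<Rightarrow> real" where
  "padic_abs p r =
     (if r = 0 then 0
      else real p powi (int (multiplicity (int p) (snd (quotient_of r)))
                        - int (multiplicity (int p) (fst (quotient_of r)))))"

lemma padic_abs_0 [simp]: "padic_abs p 0 = 0"
  by (simp add: padic_abs_def)

lemma padic_abs_divide_of_int:
  fixes a b :: int
  assumes p: "prime p" and "a \<noteq> 0" "b \<noteq> 0"
  shows "padic_abs p (of_int a / of_int b) =
           real p powi (int (multiplicity (int p) b) - int (multiplicity (int p) a))"
proof -
  define r :: rat where "r = of_int a / of_int b"
  obtain c d where cd: "quotient_of r = (c, d)" by (cases "quotient_of r")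
  have r: "r \<noteq> 0" using assms by (simp add: r_def)
  have d: "d > 0" using quotient_of_denom_pos[OF cd] .
  have rcd: "r = of_int c / of_int d" using quotient_of_div[OF cd] .
  have c: "c \<noteq> 0" using r rcd by auto
  have "of_int (a * d) = (of_int (c * b) :: rat)"
    using rcd assms d by (simp add: r_def field_simps)
  hence eq: "a * d = c * b" by (simp only: of_int_eq_iff)
  have pe: "prime_elem (int p)" using p by simp
  have "multiplicity (int p) (a * d) = multiplicity (int p) (c * b)" by (simp only: eq)
  hence "multiplicity (int p) a + multiplicity (int p) d
           = multiplicity (int p) c + multiplicity (int p) b"
    using assms c d by (simp add: prime_elem_multiplicity_mult_distrib[OF pe])
  hence "int (multiplicity (int p) d) - int (multiplicity (int p) c)
       = int (multiplicity (int p) b) - int (multiplicity (int p) a)" by linarith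
  thus ?thesis using r cd unfolding padic_abs_def r_def[symmetric] by simp
qed

lemma rat_as_divide:
  fixes r :: rat
  obtains a b :: int where "b \<noteq> 0" "r = of_int a / of_int b"
  by (metis less_irrefl quotient_of_denom_pos quotient_of_div surj_pair)

lemma padic_abs_of_int:
  assumes "prime p" "a \<noteq> 0"
  shows "padic_abs p (of_int a) = inverse (real p ^ multiplicity (int p) a)"
  using padic_abs_divide_of_int[OF assms, of 1] by (simp add: power_int_minus)

lemma padic_abs_1 [simp]: "padic_abs p 1 = 1"
  by (simp add: padic_abs_def)

lemma padic_abs_nonneg [simp]: "padic_abs p r \<ge> 0"
  by (simp add: padic_abs_def)

lemma padic_abs_eq_0_iff [simp]:
  assumes "prime p"
  shows "padic_abs p r = 0 \<longleftrightarrow> r = 0"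
  using prime_gt_0_nat[OF assms] by (simp add: padic_abs_def)

lemma padic_abs_mult:
  assumes p: "prime p"
  shows "padic_abs p (r * s) = padic_abs p r * padic_abs p s"
proof (cases "r = 0 \<or> s = 0")
  case False
  obtain a b where b: "b \<noteq> 0" and r: "r = of_int a / of_int b" by (rule rat_as_divide)
  obtain c d where d: "d \<noteq> 0" and s: "s = of_int c / of_int d" by (rule rat_as_divide)
  have ac: "a \<noteq> 0" "c \<noteq> 0" using False r s by auto
  have pe: "prime_elem (int p)" using p by simp
  have p0: "real p \<noteq> 0" using prime_gt_0_nat[OF p] by simp
  have rs: "r * s = of_int (a * c) / of_int (b * d)" by (simp add: r s)
  have "padic_abs p (r * s)
      = real p powi (int (multiplicity (int p) (b * d)) - int (multiplicity (int p) (a * c)))"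
    unfolding rs using p ac b d by (intro padic_abs_divide_of_int) auto
  also have "\<dots> = real p powi ((int (multiplicity (int p) b) - int (multiplicity (int p) a))
                     + (int (multiplicity (int p) d) - int (multiplicity (int p) c)))"
    using ac b d by (simp add: prime_elem_multiplicity_mult_distrib[OF pe] algebra_simps)
  also have "\<dots> = padic_abs p r * padic_abs p s"
    unfolding r s using p0
    by (simp add: power_int_add padic_abs_divide_of_int[OF p] ac b d)
  finally show ?thesis .
qed auto

lemma padic_abs_inverse:
  assumes p: "prime p"
  shows "padic_abs p (inverse r) = inverse (padic_abs p r)"
proof (cases "r = 0")
  case False
  have "padic_abs p r * padic_abs p (inverse r) = 1"
    using False by (simp add: padic_abs_mult[OF p, symmetric])
  thus ?thesis by (simp add: inverse_unique)
qed auto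

lemma padic_abs_minus [simp]:
  assumes p: "prime p"
  shows "padic_abs p (- r) = padic_abs p r"
proof -
  have "padic_abs p (-1) * padic_abs p (-1) = 1"
    by (simp add: padic_abs_mult[OF p, symmetric])
  hence "padic_abs p (-1) = 1"
    using padic_abs_nonneg[of p "-1"] by (metis abs_of_nonneg abs_square_eq_1 power2_eq_square)
  thus ?thesis using padic_abs_mult[OF p, of "-1" r] by simp
qed

lemma padic_abs_minus_commute:
  assumes p: "prime p"
  shows "padic_abs p (r - s) = padic_abs p (s - r)"
  using padic_abs_minus[OF p, of "r - s"] by simp

lemma padic_abs_of_int_le_1:
  assumes "prime p"
  shows "padic_abs p (of_int a) \<le> 1"
proof (cases "a = 0")
  case False
  have "real p ^ multiplicity (int p) a \<ge> 1"
    using prime_gt_0_nat[OF assms] by (intro one_le_power) simp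
  thus ?thesis using False assms by (simp add: padic_abs_of_int inverse_le_1_iff)
qed auto

lemma padic_abs_add_le_max:
  assumes p: "prime p"
  shows "padic_abs p (r + s) \<le> max (padic_abs p r) (padic_abs p s)"
proof (cases "r = 0 \<or> s = 0 \<or> r + s = 0")
  case False
  obtain a b where b: "b \<noteq> 0" and r: "r = of_int a / of_int b" by (rule rat_as_divide)
  obtain c d where d: "d \<noteq> 0" and s: "s = of_int c / of_int d" by (rule rat_as_divide)
  define u v w where "u = a * d" and "v = c * b" and "w = b * d"
  have w: "w \<noteq> 0" using b d by (simp add: w_def)
  have r': "r = of_int u / of_int w" and s': "s = of_int v / of_int w"
    using b d by (simp_all add: r s u_def v_def w_def)
  have rs: "r + s = of_int (u + v) / of_int w" by (simp add: r' s' add_divide_distrib)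
  have nz: "u \<noteq> 0" "v \<noteq> 0" "u + v \<noteq> 0" using False r' s' rs by auto
  let ?m = "multiplicity (int p)"
  have "int p ^ min (?m u) (?m v) dvd u + v"
    by (intro dvd_add multiplicity_dvd') auto
  moreover have "\<not> is_unit (int p)" using p by auto
  ultimately have m: "min (?m u) (?m v) \<le> ?m (u + v)"
    using nz by (intro multiplicity_geI) auto
  have p1: "real p \<ge> 1" using prime_gt_0_nat[OF p] by simp
  show ?thesis
    unfolding rs
    unfolding r' s' padic_abs_divide_of_int[OF p nz(1) w]
      padic_abs_divide_of_int[OF p nz(2) w] padic_abs_divide_of_int[OF p nz(3) w]
    using m p1 by (cases "?m u \<le> ?m v")
      (auto simp: le_max_iff_disj intro!: power_int_increasing)
qed (auto simp: le_max_iff_disj)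

lemma padic_abs_diff_le_max:
  assumes p: "prime p"
  shows "padic_abs p (r - s) \<le> max (padic_abs p r) (padic_abs p s)"
  using padic_abs_add_le_max[OF p, of r "- s"] p by simp

lemma padic_abs_diff_le_add:
  assumes p: "prime p"
  shows "padic_abs p (r - s) \<le> padic_abs p r + padic_abs p s"
  using padic_abs_diff_le_max[OF p, of r s] padic_abs_nonneg[of p r] padic_abs_nonneg[of p s]
  by linarith

lemma padic_abs_reverse_triangle:
  assumes p: "prime p"
  shows "\<bar>padic_abs p r - padic_abs p s\<bar> \<le> padic_abs p (r - s)"
  using padic_abs_diff_le_add[OF p, of "r - s" "- s"] padic_abs_diff_le_add[OF p, of "s - r" "- r"]
  by (simp add: p padic_abs_minus_commute[OF p, of s r])


section \<open>The field of $p$-adic numbers\<close>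

definition padic_Cauchy :: "nat \<Rightarrow> (nat \<Rightarrow> rat) \<Rightarrow> bool" where
  "padic_Cauchy p X \<longleftrightarrow> (\<forall>e>0. \<exists>M. \<forall>m\<ge>M. \<forall>n\<ge>M. padic_abs p (X m - X n) < e)"

definition padic_null :: "nat \<Rightarrow> (nat \<Rightarrow> rat) \<Rightarrow> bool" where
  "padic_null p X \<longleftrightarrow> (\<lambda>n. padic_abs p (X n)) \<longlonglongrightarrow> 0"

lemma padic_null_mono:
  assumes "padic_null p X" "\<And>n. padic_abs p (Y n) \<le> C * padic_abs p (X n)"
  shows "padic_null p Y"
  unfolding padic_null_def
proof (rule tendsto_sandwich[OF _ _ tendsto_const])
  show "(\<lambda>n. C * padic_abs p (X n)) \<longlonglongrightarrow> 0"
    using tendsto_mult_left[OF assms(1)[unfolded padic_null_def], of C] by simp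
qed (use assms(2) in auto)

lemma padic_null_add:
  assumes p: "prime p" and "padic_null p X" "padic_null p Y"
  shows "padic_null p (\<lambda>n. X n + Y n)"
  unfolding padic_null_def
proof (rule tendsto_sandwich[OF _ _ tendsto_const])
  show "(\<lambda>n. padic_abs p (X n) + padic_abs p (Y n)) \<longlonglongrightarrow> 0"
    using tendsto_add[OF assms(2,3)[unfolded padic_null_def]] by simp
  have "padic_abs p (X n + Y n) \<le> padic_abs p (X n) + padic_abs p (Y n)" for n
    using padic_abs_diff_le_add[OF p, of "X n" "- Y n"] p by simp
  thus "\<forall>\<^sub>F n in sequentially. padic_abs p (X n + Y n) \<le> padic_abs p (X n) + padic_abs p (Y n)"
    by simp
qed auto

lemma padic_null_minus:
  assumes p: "prime p" and "padic_null p X"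
  shows "padic_null p (\<lambda>n. - X n)"
  using assms by (simp add: padic_null_def)

lemma padic_null_diff_commute:
  assumes p: "prime p" and "padic_null p (\<lambda>n. X n - Y n)"
  shows "padic_null p (\<lambda>n. Y n - X n)"
  using padic_null_minus[OF assms] by simp

lemma padic_Cauchy_const [simp]: "padic_Cauchy p (\<lambda>_. r)"
  by (simp add: padic_Cauchy_def)

lemma padic_Cauchy_imp_Cauchy:
  assumes p: "prime p" and X: "padic_Cauchy p X"
  shows "Cauchy (\<lambda>n. padic_abs p (X n))"
proof (rule CauchyI)
  fix e :: real assume "e > 0"
  then obtain M where "\<forall>m\<ge>M. \<forall>n\<ge>M. padic_abs p (X m - X n) < e"
    using X unfolding padic_Cauchy_def by blast
  thus "\<exists>M. \<forall>m\<ge>M. \<forall>n\<ge>M. norm (padic_abs p (X m) - padic_abs p (X n)) < e"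
    using padic_abs_reverse_triangle[OF p] by (metis order_le_less_trans real_norm_def)
qed

lemma padic_Cauchy_convergent:
  assumes "prime p" and "padic_Cauchy p X"
  shows "convergent (\<lambda>n. padic_abs p (X n))"
  using padic_Cauchy_imp_Cauchy[OF assms] by (simp add: Cauchy_convergent_iff)

lemma padic_Cauchy_bounded:
  assumes "prime p" and "padic_Cauchy p X"
  obtains C where "C > 0" "\<And>n. padic_abs p (X n) \<le> C"
proof -
  have "Bseq (\<lambda>n. padic_abs p (X n))"
    using padic_Cauchy_imp_Cauchy[OF assms] by (rule Cauchy_Bseq)
  thus ?thesis using that unfolding Bseq_def by auto
qed

lemma padic_Cauchy_add:
  assumes p: "prime p" and "padic_Cauchy p X" "padic_Cauchy p Y"
  shows "padic_Cauchy p (\<lambda>n. X n + Y n)"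
  unfolding padic_Cauchy_def
proof (intro allI impI)
  fix e :: real assume e: "e > 0"
  obtain M where M: "\<forall>m\<ge>M. \<forall>n\<ge>M. padic_abs p (X m - X n) < e"
    using assms(2) e unfolding padic_Cauchy_def by blast
  obtain K where K: "\<forall>m\<ge>K. \<forall>n\<ge>K. padic_abs p (Y m - Y n) < e"
    using assms(3) e unfolding padic_Cauchy_def by blast
  have "padic_abs p (X m + Y m - (X n + Y n)) < e" if "m \<ge> max M K" "n \<ge> max M K" for m n
  proof -
    have "X m + Y m - (X n + Y n) = (X m - X n) + (Y m - Y n)" by simp
    also have "padic_abs p \<dots> \<le> max (padic_abs p (X m - X n)) (padic_abs p (Y m - Y n))"
      by (rule padic_abs_add_le_max[OF p])
    also have "\<dots> < e" using M K that by simp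
    finally show ?thesis .
  qed
  thus "\<exists>M. \<forall>m\<ge>M. \<forall>n\<ge>M. padic_abs p (X m + Y m - (X n + Y n)) < e" by blast
qed

lemma padic_Cauchy_minus:
  assumes p: "prime p" and "padic_Cauchy p X"
  shows "padic_Cauchy p (\<lambda>n. - X n)"
proof -
  have "padic_abs p (- X m - - X n) = padic_abs p (X m - X n)" for m n
    using padic_abs_minus[OF p, of "X m - X n"] by simp
  thus ?thesis using assms(2) by (simp only: padic_Cauchy_def)
qed

lemma padic_Cauchy_mult:
  assumes p: "prime p" and X: "padic_Cauchy p X" and Y: "padic_Cauchy p Y"
  shows "padic_Cauchy p (\<lambda>n. X n * Y n)"
  unfolding padic_Cauchy_def
proof (intro allI impI)
  fix e :: real assume e: "e > 0"
  obtain A where A: "A > 0" "\<And>n. padic_abs p (X n) \<le> A"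
    using padic_Cauchy_bounded[OF p X] by metis
  obtain B where B: "B > 0" "\<And>n. padic_abs p (Y n) \<le> B"
    using padic_Cauchy_bounded[OF p Y] by metis
  obtain M where M: "\<forall>m\<ge>M. \<forall>n\<ge>M. padic_abs p (X m - X n) < e / B"
    using X e B unfolding padic_Cauchy_def by (meson divide_pos_pos)
  obtain K where K: "\<forall>m\<ge>K. \<forall>n\<ge>K. padic_abs p (Y m - Y n) < e / A"
    using Y e A unfolding padic_Cauchy_def by (meson divide_pos_pos)
  have "padic_abs p (X m * Y m - X n * Y n) < e" if mn: "m \<ge> max M K" "n \<ge> max M K" for m n
  proof -
    have "X m * Y m - X n * Y n = X m * (Y m - Y n) + (X m - X n) * Y n"
      by (simp add: algebra_simps)
    also have "padic_abs p \<dots> \<le> max (padic_abs p (X m) * padic_abs p (Y m - Y n))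
                                    (padic_abs p (X m - X n) * padic_abs p (Y n))"
      using padic_abs_add_le_max[OF p] by (simp add: padic_abs_mult[OF p, symmetric])
    also have "\<dots> < e"
    proof -
      have "padic_abs p (X m) * padic_abs p (Y m - Y n) \<le> A * padic_abs p (Y m - Y n)"
        using A by (intro mult_right_mono) auto
      also have "\<dots> < A * (e / A)" using K mn A by (intro mult_strict_left_mono) auto
      finally have 1: "padic_abs p (X m) * padic_abs p (Y m - Y n) < e" using A by simp
      have "padic_abs p (X m - X n) * padic_abs p (Y n) \<le> padic_abs p (X m - X n) * B"
        using B by (intro mult_left_mono) auto
      also have "\<dots> < e / B * B" using M mn B by (intro mult_strict_right_mono) auto
      finally have 2: "padic_abs p (X m - X n) * padic_abs p (Y n) < e" using B by simp
      show ?thesis using 1 2 by simp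
    qed
    finally show ?thesis .
  qed
  thus "\<exists>M. \<forall>m\<ge>M. \<forall>n\<ge>M. padic_abs p (X m * Y m - X n * Y n) < e" by blast
qed

lemma padic_Cauchy_not_null:
  assumes p: "prime p" and X: "padic_Cauchy p X" and nz: "\<not> padic_null p X"
  obtains c M where "c > 0" "\<And>n. n \<ge> M \<Longrightarrow> padic_abs p (X n) \<ge> c"
proof -
  obtain L where L: "(\<lambda>n. padic_abs p (X n)) \<longlonglongrightarrow> L"
    using padic_Cauchy_convergent[OF p X] unfolding convergent_def by blast
  have "L \<ge> 0" by (rule LIMSEQ_le_const[OF L]) simp
  moreover have "L \<noteq> 0" using L nz by (auto simp: padic_null_def)
  ultimately have "L > 0" by simp
  hence "\<forall>\<^sub>F n in sequentially. padic_abs p (X n) > L / 2"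
    using L by (intro order_tendstoD(1)[OF L]) simp
  then obtain M where "\<And>n. n \<ge> M \<Longrightarrow> padic_abs p (X n) > L / 2"
    unfolding eventually_sequentially by blast
  thus ?thesis using \<open>L > 0\<close> by (intro that[of "L / 2" M]) (auto intro: less_imp_le)
qed

lemma padic_abs_inverse_diff:
  assumes p: "prime p" and "c > 0" "padic_abs p r \<ge> c" "padic_abs p s \<ge> c"
  shows "padic_abs p (inverse r - inverse s) \<le> padic_abs p (r - s) / c\<^sup>2"
proof -
  have nz: "r \<noteq> 0" "s \<noteq> 0" using assms by auto
  have "inverse r - inverse s = (s - r) * inverse (r * s)"
    using nz by (simp add: field_simps)
  hence "padic_abs p (inverse r - inverse s)
           = padic_abs p (r - s) / (padic_abs p r * padic_abs p s)"
    by (simp only: padic_abs_mult[OF p] padic_abs_inverse[OF p]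
        padic_abs_minus_commute[OF p, of s r] divide_inverse)
  also have "\<dots> \<le> padic_abs p (r - s) / c\<^sup>2"
    unfolding power2_eq_square using assms by (intro divide_left_mono mult_mono mult_pos_pos) auto
  finally show ?thesis .
qed

lemma padic_Cauchy_inverse:
  assumes p: "prime p" and X: "padic_Cauchy p X" and nz: "\<not> padic_null p X"
  shows "padic_Cauchy p (\<lambda>n. inverse (X n))"
  unfolding padic_Cauchy_def
proof (intro allI impI)
  fix e :: real assume e: "e > 0"
  obtain c K where c: "c > 0" and K: "\<And>n. n \<ge> K \<Longrightarrow> padic_abs p (X n) \<ge> c"
    using padic_Cauchy_not_null[OF assms] by blast
  obtain M where M: "\<forall>m\<ge>M. \<forall>n\<ge>M. padic_abs p (X m - X n) < e * c\<^sup>2"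
    using X e c unfolding padic_Cauchy_def by (meson mult_pos_pos zero_less_power)
  have "padic_abs p (inverse (X m) - inverse (X n)) < e" if "m \<ge> max M K" "n \<ge> max M K" for m n
  proof -
    have "padic_abs p (inverse (X m) - inverse (X n)) \<le> padic_abs p (X m - X n) / c\<^sup>2"
      using that by (intro padic_abs_inverse_diff[OF p c] K) auto
    also have "\<dots> < e" using M that c by (simp add: pos_divide_less_eq)
    finally show ?thesis .
  qed
  thus "\<exists>M. \<forall>m\<ge>M. \<forall>n\<ge>M. padic_abs p (inverse (X m) - inverse (X n)) < e" by blast
qed

text \<open>The prime \<open>p\<close> is the cardinality of the type argument, which ranges over all types of
  prime cardinality; \<open>'p padic\<close> is the completion of the rationals with respect to the
  \<open>p\<close>-adic absolute value, i.e. Cauchy sequences modulo null sequences.\<close>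

definition padic_rel :: "'p::prime_card itself \<Rightarrow> (nat \<Rightarrow> rat) \<Rightarrow> (nat \<Rightarrow> rat) \<Rightarrow> bool" where
  "padic_rel _ X Y \<longleftrightarrow>
     padic_Cauchy CARD('p) X \<and> padic_Cauchy CARD('p) Y \<and> padic_null CARD('p) (\<lambda>n. X n - Y n)"

lemma part_equivp_padic_rel: "part_equivp (padic_rel TYPE('p::prime_card))"
proof (rule part_equivpI)
  show "\<exists>X. padic_rel TYPE('p) X X"
    by (rule exI[of _ "\<lambda>_. 0"]) (simp add: padic_rel_def padic_null_def)
  show "symp (padic_rel TYPE('p))"
    by (rule sympI) (auto simp: padic_rel_def intro: padic_null_diff_commute[OF prime_card])
  show "transp (padic_rel TYPE('p))"
  proof (rule transpI)
    fix X Y Z assume "padic_rel TYPE('p) X Y" "padic_rel TYPE('p) Y Z"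
    thus "padic_rel TYPE('p) X Z"
      using padic_null_add[OF prime_card[where ?'a = 'p], of "\<lambda>n. X n - Y n" "\<lambda>n. Y n - Z n"]
      by (simp add: padic_rel_def)
  qed
qed

typedef (overloaded) ('p::prime_card) padic =
  "{C. \<exists>X. padic_rel TYPE('p) X X \<and> C = Collect (padic_rel TYPE('p) X)}"
proof -
  have "padic_rel TYPE('p) (\<lambda>_. 0) (\<lambda>_. 0)" by (simp add: padic_rel_def padic_null_def)
  thus ?thesis by blast
qed

definition to_padic :: "(nat \<Rightarrow> rat) \<Rightarrow> 'p::prime_card padic" where
  "to_padic X = Abs_padic (Collect (padic_rel TYPE('p) X))"

definition padic_repr :: "'p::prime_card padic \<Rightarrow> nat \<Rightarrow> rat" where
  "padic_repr x = (SOME X. X \<in> Rep_padic x)"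

definition cr_padic :: "(nat \<Rightarrow> rat) \<Rightarrow> 'p::prime_card padic \<Rightarrow> bool" where
  "cr_padic = (\<lambda>X x. padic_rel TYPE('p) X X \<and> to_padic X = x)"

lemma Quotient_padic:
  "Quotient (padic_rel TYPE('p::prime_card)) to_padic padic_repr (cr_padic :: _ \<Rightarrow> 'p padic \<Rightarrow> _)"
proof -
  interpret quot_type "padic_rel TYPE('p)" "Abs_padic :: _ \<Rightarrow> 'p padic" Rep_padic
    using part_equivp_padic_rel Rep_padic
    by unfold_locales (auto simp: Rep_padic_inverse Rep_padic_inject Abs_padic_inverse)
  have "abs = to_padic" "rep = padic_repr"
    by (simp_all add: fun_eq_iff abs_def rep_def to_padic_def padic_repr_def)
  thus ?thesis
    using Quotient3_to_Quotient[OF Quotient] by (simp add: cr_padic_def)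
qed

setup_lifting Quotient_padic

lemma padic_null_not_null_cong:
  assumes "prime p" "padic_null p (\<lambda>n. X n - Y n)"
  shows "padic_null p X \<longleftrightarrow> padic_null p Y"
  using padic_null_add[OF assms(1), of "\<lambda>n. X n - Y n" Y]
    padic_null_add[OF assms(1), of "\<lambda>n. Y n - X n" X]
    padic_null_diff_commute[OF assms] assms(2) by auto

instantiation padic :: (prime_card) comm_ring_1
begin

lift_definition zero_padic :: "'p::prime_card padic" is "\<lambda>_. 0"
  by (simp add: padic_rel_def padic_null_def)

lift_definition one_padic :: "'p::prime_card padic" is "\<lambda>_. 1"
  by (simp add: padic_rel_def padic_null_def)

lift_definition plus_padic :: "'p::prime_card padic \<Rightarrow> 'p padic \<Rightarrow> 'p padic"
  is "\<lambda>X Y n. X n + Y n"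
proof -
  fix X X' Y Y' assume *: "padic_rel TYPE('p) X X'" "padic_rel TYPE('p) Y Y'"
  have "padic_null CARD('p) (\<lambda>n. (X n - X' n) + (Y n - Y' n))"
    using * by (intro padic_null_add[OF prime_card]) (auto simp: padic_rel_def)
  moreover have "(\<lambda>n. (X n - X' n) + (Y n - Y' n)) = (\<lambda>n. X n + Y n - (X' n + Y' n))"
    by (simp add: fun_eq_iff)
  ultimately show "padic_rel TYPE('p) (\<lambda>n. X n + Y n) (\<lambda>n. X' n + Y' n)"
    using * by (simp add: padic_rel_def padic_Cauchy_add[OF prime_card])
qed

lift_definition uminus_padic :: "'p::prime_card padic \<Rightarrow> 'p padic" is "\<lambda>X n. - X n"
proof -
  fix X X' assume *: "padic_rel TYPE('p) X X'"
  have "padic_null CARD('p) (\<lambda>n. - (X n - X' n))"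
    using * by (intro padic_null_minus[OF prime_card]) (auto simp: padic_rel_def)
  thus "padic_rel TYPE('p) (\<lambda>n. - X n) (\<lambda>n. - X' n)"
    using * by (simp add: padic_rel_def padic_Cauchy_minus[OF prime_card])
qed

definition minus_padic :: "'p::prime_card padic \<Rightarrow> 'p padic \<Rightarrow> 'p padic" where
  "minus_padic x y = x + - y"

lift_definition times_padic :: "'p::prime_card padic \<Rightarrow> 'p padic \<Rightarrow> 'p padic"
  is "\<lambda>X Y n. X n * Y n"
proof -
  fix X X' Y Y' assume *: "padic_rel TYPE('p) X X'" "padic_rel TYPE('p) Y Y'"
  note p = prime_card[where ?'a = 'p]
  obtain A where A: "\<And>n. padic_abs CARD('p) (X n) \<le> A"
    using padic_Cauchy_bounded[OF p, of X] * by (auto simp: padic_rel_def)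
  obtain B where B: "\<And>n. padic_abs CARD('p) (Y' n) \<le> B"
    using padic_Cauchy_bounded[OF p, of Y'] * by (auto simp: padic_rel_def)
  have "padic_null CARD('p) (\<lambda>n. X n * (Y n - Y' n))"
    by (rule padic_null_mono[where X = "\<lambda>n. Y n - Y' n" and C = A])
      (use * A in \<open>auto simp: padic_rel_def padic_abs_mult[OF p] intro!: mult_right_mono\<close>)
  moreover have "padic_null CARD('p) (\<lambda>n. (X n - X' n) * Y' n)"
    by (rule padic_null_mono[where X = "\<lambda>n. X n - X' n" and C = B])
      (use * B in \<open>auto simp: padic_rel_def padic_abs_mult[OF p] mult.commute[of B]
        intro!: mult_left_mono\<close>)
  ultimately have "padic_null CARD('p) (\<lambda>n. X n * (Y n - Y' n) + (X n - X' n) * Y' n)"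
    by (rule padic_null_add[OF p])
  moreover have "(\<lambda>n. X n * (Y n - Y' n) + (X n - X' n) * Y' n)
                   = (\<lambda>n. X n * Y n - X' n * Y' n)"
    by (simp add: fun_eq_iff algebra_simps)
  ultimately show "padic_rel TYPE('p) (\<lambda>n. X n * Y n) (\<lambda>n. X' n * Y' n)"
    using * by (simp add: padic_rel_def padic_Cauchy_mult[OF p])
qed

instance
proof
  fix x y z :: "'p::prime_card padic"
  note refl_rel = padic_rel_def padic_null_def padic_Cauchy_add[OF prime_card]
    padic_Cauchy_mult[OF prime_card] padic_Cauchy_minus[OF prime_card]
  show "x + y + z = x + (y + z)"
    by transfer (simp add: refl_rel add.assoc)
  show "x + y = y + x"
    by transfer (simp add: refl_rel add.commute)
  show "0 + x = x"
    by transfer (simp add: refl_rel)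
  show "- x + x = 0"
    by transfer (simp add: refl_rel)
  show "x - y = x + - y"
    by (simp add: minus_padic_def)
  show "x * y * z = x * (y * z)"
    by transfer (simp add: refl_rel mult.assoc)
  show "x * y = y * x"
    by transfer (simp add: refl_rel mult.commute)
  show "1 * x = x"
    by transfer (simp add: refl_rel)
  show "(x + y) * z = x * z + y * z"
    by transfer (simp add: refl_rel distrib_right)
  show "(0 :: 'p padic) \<noteq> 1"
    by transfer (simp add: refl_rel LIMSEQ_const_iff padic_abs_minus[OF prime_card])
qed

end

instantiation padic :: (prime_card) field
begin

lift_definition inverse_padic :: "'p::prime_card padic \<Rightarrow> 'p padic"
  is "\<lambda>X. if padic_null CARD('p) X then (\<lambda>_. 0) else (\<lambda>n. inverse (X n))"
proof -
  fix X Y assume *: "padic_rel TYPE('p) X Y"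
  note p = prime_card[where ?'a = 'p]
  have CX: "padic_Cauchy CARD('p) X" and CY: "padic_Cauchy CARD('p) Y"
    and XY: "padic_null CARD('p) (\<lambda>n. X n - Y n)"
    using * by (auto simp: padic_rel_def)
  have iff: "padic_null CARD('p) X \<longleftrightarrow> padic_null CARD('p) Y"
    by (rule padic_null_not_null_cong[OF p XY])
  have "padic_null CARD('p) (\<lambda>n. inverse (X n) - inverse (Y n))"
    if nX: "\<not> padic_null CARD('p) X" and nY: "\<not> padic_null CARD('p) Y"
  proof -
    obtain c M where c: "c > 0" "\<And>n. n \<ge> M \<Longrightarrow> padic_abs CARD('p) (X n) \<ge> c"
      using padic_Cauchy_not_null[OF p CX nX] by blast
    obtain d K where d: "d > 0" "\<And>n. n \<ge> K \<Longrightarrow> padic_abs CARD('p) (Y n) \<ge> d"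
      using padic_Cauchy_not_null[OF p CY nY] by blast
    have "padic_abs CARD('p) (inverse (X n) - inverse (Y n))
            \<le> padic_abs CARD('p) (X n - Y n) / (min c d)\<^sup>2" if "n \<ge> max M K" for n
      using that c(1) d(1) c(2)[of n] d(2)[of n] by (intro padic_abs_inverse_diff[OF p]) auto
    hence bound: "\<forall>\<^sub>F n in sequentially. padic_abs CARD('p) (inverse (X n) - inverse (Y n))
            \<le> padic_abs CARD('p) (X n - Y n) / (min c d)\<^sup>2"
      unfolding eventually_sequentially by blast
    have lim: "(\<lambda>n. padic_abs CARD('p) (X n - Y n) / (min c d)\<^sup>2) \<longlonglongrightarrow> 0"
      using tendsto_divide_zero[OF XY[unfolded padic_null_def]] .
    show ?thesis
      unfolding padic_null_def by (rule tendsto_sandwich[OF _ bound tendsto_const lim]) simp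
  qed
  moreover have "padic_null CARD('p) (\<lambda>_. 0)" by (simp add: padic_null_def)
  ultimately show "padic_rel TYPE('p)
          (if padic_null CARD('p) X then (\<lambda>_. 0) else (\<lambda>n. inverse (X n)))
          (if padic_null CARD('p) Y then (\<lambda>_. 0) else (\<lambda>n. inverse (Y n)))"
    using iff CX CY by (simp add: padic_rel_def padic_Cauchy_inverse[OF p])
qed

definition divide_padic :: "'p::prime_card padic \<Rightarrow> 'p padic \<Rightarrow> 'p padic" where
  "divide_padic x y = x * inverse y"

instance
proof
  fix x y :: "'p::prime_card padic"
  show "inverse (0 :: 'p padic) = 0"
    by transfer (simp add: padic_rel_def padic_null_def)
  show "x div y = x * inverse y"
    by (rule divide_padic_def)
  show "x \<noteq> 0 \<Longrightarrow> inverse x * x = 1"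
  proof transfer
    fix X assume *: "padic_rel TYPE('p) X X" "\<not> padic_rel TYPE('p) X (\<lambda>_. 0)"
    note p = prime_card[where ?'a = 'p]
    have CX: "padic_Cauchy CARD('p) X" and nX: "\<not> padic_null CARD('p) X"
      using * by (auto simp: padic_rel_def)
    obtain c M where c: "c > 0" "\<And>n. n \<ge> M \<Longrightarrow> padic_abs CARD('p) (X n) \<ge> c"
      using padic_Cauchy_not_null[OF p CX nX] by blast
    have "X n \<noteq> 0" if "n \<ge> M" for n using c(1) c(2)[OF that] by auto
    hence "\<forall>\<^sub>F n in sequentially. padic_abs CARD('p) (inverse (X n) * X n - 1) = 0"
      unfolding eventually_sequentially by (intro exI[of _ M]) auto
    hence "padic_null CARD('p) (\<lambda>n. inverse (X n) * X n - 1)"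
      unfolding padic_null_def by (rule tendsto_eventually)
    thus "padic_rel TYPE('p)
            (\<lambda>n. (if padic_null CARD('p) X then (\<lambda>_. 0) else (\<lambda>n. inverse (X n))) n * X n)
            (\<lambda>_. 1)"
      using nX CX by (simp add: padic_rel_def padic_Cauchy_mult[OF p] padic_Cauchy_inverse[OF p])
  qed
qed

end

text \<open>The \<open>p\<close>-adic absolute value on \<open>'p padic\<close>, extended from the rationals by continuity.\<close>

lift_definition padic_norm :: "'p::prime_card padic \<Rightarrow> real"
  is "\<lambda>X. lim (\<lambda>n. padic_abs CARD('p) (X n))"
proof -
  fix X Y assume *: "padic_rel TYPE('p) X Y"
  note p = prime_card[where ?'a = 'p]
  have "(\<lambda>n. padic_abs CARD('p) (X n)) \<longlonglongrightarrow> lim (\<lambda>n. padic_abs CARD('p) (X n))"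
    using * padic_Cauchy_convergent[OF p] by (simp add: padic_rel_def convergent_LIMSEQ_iff)
  moreover have "(\<lambda>n. padic_abs CARD('p) (X n) - padic_abs CARD('p) (Y n)) \<longlonglongrightarrow> 0"
    by (rule tendsto_0_le[where K = 1 and f = "\<lambda>n. padic_abs CARD('p) (X n - Y n)"])
      (use * in \<open>auto simp: padic_rel_def padic_null_def padic_abs_reverse_triangle[OF p]\<close>)
  ultimately have "(\<lambda>n. padic_abs CARD('p) (Y n)) \<longlonglongrightarrow> lim (\<lambda>n. padic_abs CARD('p) (X n))"
    using tendsto_diff by fastforce
  thus "lim (\<lambda>n. padic_abs CARD('p) (X n)) = lim (\<lambda>n. padic_abs CARD('p) (Y n))"
    by (simp add: limI)
qed

lemma padic_rel_LIMSEQ: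
  assumes "padic_rel TYPE('p::prime_card) X Y"
  shows "(\<lambda>n. padic_abs CARD('p) (X n)) \<longlonglongrightarrow> lim (\<lambda>n. padic_abs CARD('p) (X n))"
  using assms padic_Cauchy_convergent[OF prime_card[where ?'a = 'p]]
  by (simp add: padic_rel_def convergent_LIMSEQ_iff)

lemma padic_norm_nonneg [simp]: "padic_norm x \<ge> 0"
proof (transfer, goal_cases)
  case (1 X)
  show ?case by (rule LIMSEQ_le_const[OF padic_rel_LIMSEQ[OF 1]]) simp
qed

lemma padic_norm_eq_0_iff [simp]: "padic_norm x = 0 \<longleftrightarrow> x = 0"
proof (transfer, goal_cases)
  case (1 X)
  show ?case
  proof
    assume "lim (\<lambda>n. padic_abs CARD('a) (X n)) = 0"
    thus "padic_rel TYPE('a) X (\<lambda>_. 0)"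
      using padic_rel_LIMSEQ[OF 1] 1 by (simp add: padic_rel_def padic_null_def)
  next
    assume "padic_rel TYPE('a) X (\<lambda>_. 0)"
    thus "lim (\<lambda>n. padic_abs CARD('a) (X n)) = 0"
      by (auto simp: padic_rel_def padic_null_def intro: limI)
  qed
qed

lemma padic_norm_mult: "padic_norm (x * y) = padic_norm x * padic_norm y"
proof (transfer, goal_cases)
  case (1 X Y)
  show ?case
    using tendsto_mult[OF padic_rel_LIMSEQ[OF 1(1)] padic_rel_LIMSEQ[OF 1(2)]]
    by (intro limI) (simp add: padic_abs_mult[OF prime_card])
qed

lemma padic_norm_add_le_max: "padic_norm (x + y) \<le> max (padic_norm x) (padic_norm y)"
proof (transfer, goal_cases)
  case (1 X Y)
  note p = prime_card[where ?'a = 'a]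
  have "padic_rel TYPE('a) (\<lambda>n. X n + Y n) (\<lambda>n. X n + Y n)"
    using 1 by (simp add: padic_rel_def padic_Cauchy_add[OF p] padic_null_def)
  note L = padic_rel_LIMSEQ[OF this]
  show ?case
    by (rule LIMSEQ_le[OF L tendsto_max[OF padic_rel_LIMSEQ[OF 1(1)] padic_rel_LIMSEQ[OF 1(2)]]])
      (simp add: padic_abs_add_le_max[OF p])
qed

lemma of_nat_padic_transfer: "of_nat n = (to_padic (\<lambda>_. of_nat n) :: 'p::prime_card padic)"
proof (induction n)
  case 0
  show ?case by (simp add: zero_padic_def)
next
  case (Suc n)
  have r: "padic_rel TYPE('p) (\<lambda>_. c) (\<lambda>_. c)" for c
    by (simp add: padic_rel_def padic_null_def)
  show ?case using plus_padic.abs_eq[OF r r, of 1 "of_nat n"] by (simp add: Suc one_padic_def)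
qed

lemma padic_norm_of_nat:
  "padic_norm (of_nat n :: 'p::prime_card padic) = padic_abs CARD('p) (of_nat n)"
proof -
  have "padic_rel TYPE('p) (\<lambda>_. of_nat n) (\<lambda>_. of_nat n)"
    by (simp add: padic_rel_def padic_null_def)
  thus ?thesis by (simp add: of_nat_padic_transfer padic_norm.abs_eq)
qed


section \<open>The Cayley tree and the Potts recursion\<close>

text \<open>Vertices of the semi-infinite Cayley tree of order \<open>k\<close> in the usual coordinates: the word
  \<open>[i\<^sub>1, \<dots>, i\<^sub>n]\<close> is the vertex reached from the root \<open>[]\<close> by passing to the \<open>i\<^sub>1\<close>-th direct
  successor, then to its \<open>i\<^sub>2\<close>-th direct successor, and so on.\<close>

definition cayley_vertices :: "nat \<Rightarrow> nat list set" where
  "cayley_vertices k = lists {1..k}"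

definition cayley_root :: "nat list" where
  "cayley_root = []"

definition cayley_succ :: "nat list \<Rightarrow> nat \<Rightarrow> nat list" where
  "cayley_succ x i = x @ [i]"

text \<open>If \<open>|q| < 1\<close>, \<open>|\<theta>| < 1\<close> and \<open>|t| \<noteq> 1\<close>, then \<open>|\<theta> + q - 1| = 1\<close> and the denominator does not
  vanish, so the convention \<open>x / 0 = 0\<close> plays no role there.\<close>

definition potts_g :: "'a::field \<Rightarrow> 'a \<Rightarrow> 'a \<Rightarrow> 'a" where
  "potts_g \<theta> q t = (\<theta> * t + q) / (t + \<theta> + q - 1)"

text \<open>The definite description is proper whenever \<open>|q| < 1\<close> and \<open>|\<theta>| \<le> |q|\<^sup>2\<close>: the product of the
  two roots is \<open>q\<^sup>2\<close> and exactly one of them has absolute value 1.\<close>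

definition potts_x1 :: "'p::prime_card padic \<Rightarrow> 'p padic \<Rightarrow> 'p padic" where
  "potts_x1 \<theta> q =
     (THE x. x\<^sup>2 + (2 * \<theta> - \<theta>\<^sup>2 + 2 * q - 1) * x + q\<^sup>2 = 0 \<and> padic_norm x = (padic_norm q)\<^sup>2)"

end

theory Submission
  imports Defs
begin

text \<open>For \<open>|t| \<noteq> 1\<close> one has \<open>|g t| \<le> |q|\<close>, so every \<open>h\<^sub>x\<close> lies in the open unit disc, where \<open>|g| = |q|\<close>
  and \<open>g\<close> scales distances by \<open>|q|\<close>. Comparing the recursion at two arbitrary vertices then gives
  \<open>|h\<^sub>x - h\<^sub>y| \<le> |q|\<^sup>2\<^sup>n\<close> for all \<open>n\<close>, so \<open>h\<close> is constant. Its value is a fixed point of \<open>g\<^sup>2\<close> other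
  than \<open>1\<close>, hence a root of the quadratic; since \<open>h\<close> itself supplies this root, no appeal to
  completeness or Hensel's lemma is needed.\<close>

lemma padic_norm_0 [simp]: "padic_norm 0 = 0"
  by simp

lemma padic_norm_1 [simp]: "padic_norm (1 :: 'p::prime_card padic) = 1"
  using padic_norm_of_nat[of 1, where 'p = 'p] by simp

lemma padic_norm_minus [simp]: "padic_norm (- x) = padic_norm x"
proof -
  have "(padic_norm (- 1 :: 'a padic))\<^sup>2 = 1"
    using padic_norm_mult[of "- 1 :: 'a padic" "- 1"] by (simp add: power2_eq_square)
  hence "padic_norm (- 1 :: 'a padic) = 1"
    using padic_norm_nonneg[of "- 1 :: 'a padic"] by (auto simp: power2_eq_1_iff)
  thus ?thesis using padic_norm_mult[of "- 1" x] by simp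
qed

lemma padic_norm_diff_le_max: "padic_norm (x - y) \<le> max (padic_norm x) (padic_norm y)"
  using padic_norm_add_le_max[of x "- y"] by simp

text \<open>Writing \<open>x\<close> as \<open>(x + y) - y\<close> bounds its norm by the larger of
  those of \<open>x + y\<close> and \<open>y\<close>, and the latter is too small.\<close>

lemma padic_norm_add_eq_left:
  assumes "padic_norm y < padic_norm x"
  shows "padic_norm (x + y) = padic_norm x"
  using padic_norm_add_le_max[of x y] padic_norm_diff_le_max[of "x + y" y] assms by auto

lemma padic_norm_add_eq_right:
  assumes "padic_norm x < padic_norm y"
  shows "padic_norm (x + y) = padic_norm y"
  using padic_norm_add_eq_left[OF assms] by (simp add: add.commute)

lemma padic_norm_power: "padic_norm (x ^ n) = padic_norm x ^ n"
  by (induction n) (simp_all add: padic_norm_mult)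

lemma padic_norm_divide: "padic_norm (x / y) = padic_norm x / padic_norm y"
proof (cases "y = 0")
  case False
  thus ?thesis using padic_norm_mult[of "x / y" y] by (simp add: field_simps)
qed simp

text \<open>Serves to compare the recursion at two vertices, where all four factors are values of
  \<open>potts_g\<close>.\<close>

lemma padic_norm_mult_diff_le:
  "padic_norm (a * b - c * d)
     \<le> max (padic_norm a * padic_norm (b - d)) (padic_norm d * padic_norm (a - c))"
proof -
  have "a * b - c * d = a * (b - d) + d * (a - c)" by (simp add: algebra_simps)
  thus ?thesis by (metis padic_norm_add_le_max padic_norm_mult)
qed

lemma padic_norm_unit_add:
  assumes "padic_norm \<theta> < 1" "padic_norm Q < 1"
  shows "padic_norm (\<theta> + Q - 1) = 1"
  using padic_norm_add_eq_right[of "\<theta> + Q" "- 1"] padic_norm_add_le_max[of \<theta> Q] assms by simp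

text \<open>The unit \<open>\<theta> + Q - 1\<close> and \<open>t\<close> have different norms, so
  the larger one wins. This also shows that the denominator of \<open>potts_g\<close> is
  nonzero.\<close>

lemma potts_denominator_norm:
  assumes "padic_norm \<theta> < 1" "padic_norm Q < 1" "padic_norm t \<noteq> 1"
  shows "padic_norm (t + \<theta> + Q - 1) = max (padic_norm t) 1"
  using padic_norm_unit_add[OF assms(1,2)] assms(3)
    padic_norm_add_eq_left[of "\<theta> + Q - 1" t] padic_norm_add_eq_right[of t "\<theta> + Q - 1"]
  by (cases "padic_norm t < 1") (auto simp: add.assoc add_diff_eq)

text \<open>\<open>Q\<close> dominates the numerator and the denominator is a unit.\<close>

lemma padic_norm_potts_g:
  assumes "padic_norm \<theta> < padic_norm Q" "padic_norm Q < 1" "padic_norm t < 1"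
  shows "padic_norm (potts_g \<theta> Q t) = padic_norm Q"
proof -
  have "padic_norm \<theta> * padic_norm t \<le> padic_norm \<theta>"
    using assms(3) by (intro mult_left_le) auto
  hence "padic_norm (\<theta> * t + Q) = padic_norm Q"
    using assms(1) by (intro padic_norm_add_eq_right) (simp add: padic_norm_mult)
  thus ?thesis
    using potts_denominator_norm[of \<theta> Q t] assms by (simp add: potts_g_def padic_norm_divide)
qed

lemma padic_norm_potts_g_le:
  assumes "padic_norm \<theta> < padic_norm Q" "padic_norm Q < 1" "padic_norm t \<noteq> 1"
  shows "padic_norm (potts_g \<theta> Q t) \<le> padic_norm Q"
proof (cases "padic_norm t < 1")
  case False
  hence t: "padic_norm t > 1" using assms(3) by simp
  \<comment> \<open>For large \<open>t\<close> the denominator has the norm of \<open>t\<close>, so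
    a numerator bound linear in that norm suffices.\<close>
  have "padic_norm (\<theta> * t + Q) \<le> max (padic_norm \<theta> * padic_norm t) (padic_norm Q)"
    using padic_norm_add_le_max[of "\<theta> * t" Q] by (simp add: padic_norm_mult)
  also have "\<dots> \<le> padic_norm Q * padic_norm t"
    using t assms(1) mult_left_mono[of 1 "padic_norm t" "padic_norm Q"]
    by (auto intro!: mult_right_mono)
  finally show ?thesis
    using potts_denominator_norm[of \<theta> Q t] assms t
    by (simp add: potts_g_def padic_norm_divide divide_le_eq)
qed (use padic_norm_potts_g[OF assms(1,2)] in simp)

lemma padic_norm_potts_g_diff:
  fixes \<theta> Q s t :: "'p::prime_card padic"
  assumes \<theta>: "padic_norm \<theta> < padic_norm Q" and Q: "padic_norm Q < 1"
    and s: "padic_norm s < 1" and t: "padic_norm t < 1"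
  shows "padic_norm (potts_g \<theta> Q s - potts_g \<theta> Q t) = padic_norm Q * padic_norm (s - t)"
proof -
  define c where "c = \<theta> + Q - 1"
  have c: "padic_norm c = 1" using padic_norm_unit_add[of \<theta> Q] \<theta> Q by (simp add: c_def)
  have den: "padic_norm (s + c) = 1" "padic_norm (t + c) = 1"
    using padic_norm_add_eq_right[of _ c] s t c by simp_all
  hence nz: "s + c \<noteq> 0" "t + c \<noteq> 0" by auto
  have "potts_g \<theta> Q s - potts_g \<theta> Q t = (\<theta> * s + Q) / (s + c) - (\<theta> * t + Q) / (t + c)"
    by (simp add: potts_g_def c_def add.assoc add_diff_eq)
  \<comment> \<open>\<open>potts_g\<close> is a Moebius map with determinant
    \<open>\<theta> * c - Q\<close>; here \<open>Q\<close> dominates, and both denominators are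
    units.\<close>
  also have "\<dots> = (\<theta> * c - Q) * (s - t) / ((s + c) * (t + c))"
    using nz by (simp add: divide_simps) (simp add: algebra_simps)
  finally have "padic_norm (potts_g \<theta> Q s - potts_g \<theta> Q t) = padic_norm (\<theta> * c - Q) * padic_norm (s - t)"
    using den by (simp add: padic_norm_divide padic_norm_mult)
  moreover have "padic_norm (\<theta> * c - Q) = padic_norm Q"
    using padic_norm_add_eq_right[of "\<theta> * c" "- Q"] \<theta> c by (simp add: padic_norm_mult)
  ultimately show ?thesis by simp
qed

text \<open>The fixed point equation of \<open>g\<^sup>2\<close> is the quadratic multiplied by \<open>x - 1\<close>.\<close>

lemma potts_g_fixed_point_root:
  fixes x :: "'a::field"
  assumes fp: "x = potts_g \<theta> Q x * potts_g \<theta> Q x" and den: "x + \<theta> + Q - 1 \<noteq> 0" and "x \<noteq> 1"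
  shows "x\<^sup>2 + (2 * \<theta> - \<theta>\<^sup>2 + 2 * Q - 1) * x + Q\<^sup>2 = 0"
proof -
  have "x * (x + \<theta> + Q - 1)\<^sup>2 = (\<theta> * x + Q)\<^sup>2"
    using fp den by (simp add: potts_g_def power2_eq_square divide_simps)
  moreover have "(x - 1) * (x\<^sup>2 + (2 * \<theta> - \<theta>\<^sup>2 + 2 * Q - 1) * x + Q\<^sup>2)
      = x * (x + \<theta> + Q - 1)\<^sup>2 - (\<theta> * x + Q)\<^sup>2"
    by (simp add: power2_eq_square ring_distribs)
  ultimately have "(x - 1) * (x\<^sup>2 + (2 * \<theta> - \<theta>\<^sup>2 + 2 * Q - 1) * x + Q\<^sup>2) = 0"
    by (simp only: diff_self)
  thus ?thesis using \<open>x \<noteq> 1\<close> by simp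
qed

text \<open>Two distinct roots would sum to minus the linear coefficient, which has norm 1, whereas
  roots of norm \<open>(padic_norm Q)\<^sup>2\<close> have a sum of norm below 1.\<close>

lemma potts_x1_eqI:
  assumes \<theta>: "padic_norm \<theta> < 1" and Q: "padic_norm Q < 1"
    and root: "x\<^sup>2 + (2 * \<theta> - \<theta>\<^sup>2 + 2 * Q - 1) * x + Q\<^sup>2 = 0"
    and norm: "padic_norm x = (padic_norm Q)\<^sup>2"
  shows "potts_x1 \<theta> Q = x"
  unfolding potts_x1_def
proof (rule the_equality)
  fix y
  assume y: "y\<^sup>2 + (2 * \<theta> - \<theta>\<^sup>2 + 2 * Q - 1) * y + Q\<^sup>2 = 0 \<and> padic_norm y = (padic_norm Q)\<^sup>2"
  have small_add: "padic_norm (a + b) < 1" if "padic_norm a < 1" "padic_norm b < 1" for a b :: "'a padic"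
    using padic_norm_add_le_max[of a b] that by simp
  have sq: "(padic_norm a)\<^sup>2 < 1" if "padic_norm a < 1" for a :: "'a padic"
    using that by (simp add: power_less_one_iff)
  \<comment> \<open>This sum is \<open>x + y\<close> plus the linear coefficient without its
    \<open>-1\<close>, split into small summands to fit \<open>small_add\<close>.\<close>
  have "padic_norm ((x + y) + ((\<theta> + \<theta>) + (- \<theta>\<^sup>2 + (Q + Q)))) < 1"
    using sq[OF Q] sq[OF \<theta>] norm y \<theta> Q by (intro small_add) (simp_all add: padic_norm_power)
  hence "padic_norm ((x + y) + ((\<theta> + \<theta>) + (- \<theta>\<^sup>2 + (Q + Q))) + - 1) = 1"
    by (subst padic_norm_add_eq_right) simp_all
  hence "(x + y) + ((\<theta> + \<theta>) + (- \<theta>\<^sup>2 + (Q + Q))) + - 1 \<noteq> 0" by (metis padic_norm_0 zero_neq_one)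
  moreover have "(y - x) * ((x + y) + ((\<theta> + \<theta>) + (- \<theta>\<^sup>2 + (Q + Q))) + - 1)
      = (y\<^sup>2 + (2 * \<theta> - \<theta>\<^sup>2 + 2 * Q - 1) * y + Q\<^sup>2) - (x\<^sup>2 + (2 * \<theta> - \<theta>\<^sup>2 + 2 * Q - 1) * x + Q\<^sup>2)"
    by (simp add: power2_eq_square ring_distribs)
  hence "(y - x) * ((x + y) + ((\<theta> + \<theta>) + (- \<theta>\<^sup>2 + (Q + Q))) + - 1) = 0"
    by (simp only: root y diff_self)
  ultimately have "y - x = 0" by (metis mult_eq_0_iff)
  thus "y = x" by (simp only: right_minus_eq)
qed (use root norm in simp)

lemma cayley_succ_nonroot:
  assumes "x \<in> cayley_vertices k - {cayley_root}" "i \<in> {1..k}"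
  shows "cayley_succ x i \<in> cayley_vertices k - {cayley_root}"
  using assms by (auto simp: cayley_vertices_def cayley_root_def cayley_succ_def)

text \<open>The two vertices are unrelated in the tree: the induction descends from both at once
  through \<open>l\<close> and \<open>r\<close>.\<close>

lemma potts_solution_constant:
  fixes \<theta> Q :: "'p::prime_card padic"
  assumes \<theta>: "padic_norm \<theta> < padic_norm Q" and Q: "padic_norm Q < 1"
    and rec: "\<And>x. x \<in> V \<Longrightarrow> h x = potts_g \<theta> Q (h (l x)) * potts_g \<theta> Q (h (r x))"
    and closed: "\<And>x. x \<in> V \<Longrightarrow> l x \<in> V \<and> r x \<in> V"
    and small: "\<And>x. x \<in> V \<Longrightarrow> padic_norm (h x) < 1"
    and xy: "x \<in> V" "y \<in> V"
  shows "h x = h y"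
proof -
  note g_norm = padic_norm_potts_g[OF \<theta> Q] and g_diff = padic_norm_potts_g_diff[OF \<theta> Q]
  have bound: "padic_norm (h x - h y) \<le> ((padic_norm Q)\<^sup>2) ^ n" if "x \<in> V" "y \<in> V" for n x y
    using that
  proof (induction n arbitrary: x y)
    case 0
    thus ?case using padic_norm_diff_le_max[of "h x" "h y"] small[of x] small[of y] by simp
  next
    case (Suc n)
    note V = closed[OF Suc.prems(1)] closed[OF Suc.prems(2)]
    \<comment> \<open>Each branch gains \<open>padic_norm Q\<close> twice: once from the factor kept
      fixed, once from the contraction of the other.\<close>
    have "padic_norm (h x - h y)
        \<le> max (padic_norm Q * (padic_norm Q * padic_norm (h (r x) - h (r y))))
              (padic_norm Q * (padic_norm Q * padic_norm (h (l x) - h (l y))))"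
      using padic_norm_mult_diff_le[of "potts_g \<theta> Q (h (l x))" "potts_g \<theta> Q (h (r x))"
          "potts_g \<theta> Q (h (l y))" "potts_g \<theta> Q (h (r y))"] V
      by (simp add: rec[OF Suc.prems(1)] rec[OF Suc.prems(2)] g_norm g_diff small)
    also have "\<dots> \<le> (padic_norm Q)\<^sup>2 * ((padic_norm Q)\<^sup>2) ^ n"
      using Suc.IH V by (auto simp: power2_eq_square mult.assoc intro!: mult_left_mono)
    finally show ?case by simp
  qed
  have "(\<lambda>n. ((padic_norm Q)\<^sup>2) ^ n) \<longlonglongrightarrow> 0"
    using Q by (intro LIMSEQ_power_zero) (simp add: power_less_one_iff)
  hence "padic_norm (h x - h y) \<le> 0"
    by (rule LIMSEQ_le_const) (use bound[OF xy] in blast)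
  hence "padic_norm (h x - h y) = 0"
    using padic_norm_nonneg[of "h x - h y"] by linarith
  thus ?thesis by simp
qed

theorem theorem5p5:
  fixes p q N :: nat
    and \<theta> Q :: "'p::prime_card padic"
    and h :: "nat list \<Rightarrow> 'p padic"
  assumes "p = CARD('p)" and "p \<ge> 3"
    and "q \<ge> 1" and "N \<ge> 1"
    and "\<theta> = of_nat p ^ N" and "Q = of_nat q"
    and "padic_norm Q < 1"
    and "padic_norm \<theta> \<le> (padic_norm Q)\<^sup>2"
    and "\<forall>x \<in> cayley_vertices 2 - {cayley_root}.
           h x = potts_g \<theta> Q (h (cayley_succ x 1)) * potts_g \<theta> Q (h (cayley_succ x 2))"
    and "\<forall>x \<in> cayley_vertices 2 - {cayley_root}. padic_norm (h x) \<noteq> 1"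
  shows "\<forall>x \<in> cayley_vertices 2 - {cayley_root}. h x = potts_x1 \<theta> Q"
proof
  let ?V = "cayley_vertices 2 - {cayley_root}"
  fix x assume x: "x \<in> ?V"
  have rec: "h x = potts_g \<theta> Q (h (cayley_succ x 1)) * potts_g \<theta> Q (h (cayley_succ x 2))"
    if "x \<in> ?V" for x
    using assms(9) that by blast
  have closed: "cayley_succ x 1 \<in> ?V \<and> cayley_succ x 2 \<in> ?V" if "x \<in> ?V" for x
    using cayley_succ_nonroot[OF that, of 1] cayley_succ_nonroot[OF that, of 2] by simp
  have Q: "padic_norm Q < 1" by fact
  \<comment> \<open>A positive integer is nonzero in characteristic 0. This makes
    \<open>(padic_norm Q)\<^sup>2 < padic_norm Q\<close> strict, hence \<open>\<theta>\<close>
    strictly smaller than \<open>Q\<close>.\<close>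
  have "padic_norm Q \<noteq> 0"
    using assms(6) \<open>q \<ge> 1\<close> padic_abs_eq_0_iff[OF prime_card[where ?'a = 'p], of "of_nat q"]
    by (simp del: padic_norm_eq_0_iff add: padic_norm_of_nat)
  hence "padic_norm Q > 0"
    using padic_norm_nonneg[of Q] by linarith
  hence "(padic_norm Q)\<^sup>2 < padic_norm Q"
    using Q by (simp add: power2_eq_square)
  hence \<theta>: "padic_norm \<theta> < padic_norm Q" using assms(8) by linarith
  have ne1: "padic_norm (h x) \<noteq> 1" if "x \<in> ?V" for x
    using assms(10) that by blast
  \<comment> \<open>The successors may still have norm above 1 at this point; the bound on
    \<open>potts_g\<close> away from the unit sphere covers both cases.\<close>
  have small: "padic_norm (h x) < 1" if "x \<in> ?V" for x
  proof -
    note V = closed[OF that]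
    have "padic_norm (h x) \<le> padic_norm Q * padic_norm Q"
      using V by (simp only: rec[OF that] padic_norm_mult)
        (intro mult_mono padic_norm_potts_g_le \<theta> Q ne1; simp)
    also have "\<dots> < 1" using \<open>(padic_norm Q)\<^sup>2 < padic_norm Q\<close> Q by (simp add: power2_eq_square)
    finally show ?thesis .
  qed
  have const: "h y = h x" if "y \<in> ?V" for y
    by (rule potts_solution_constant[OF \<theta> Q rec closed small that x])
  have "h (cayley_succ x 1) = h x" "h (cayley_succ x 2) = h x"
    using const closed[OF x] by blast+
  from rec[OF x, unfolded this]
  have fp: "h x = potts_g \<theta> Q (h x) * potts_g \<theta> Q (h x)" .
  have "padic_norm (h x + \<theta> + Q - 1) = 1"
    using potts_denominator_norm[of \<theta> Q "h x"] \<theta> Q small[OF x] by simp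
  hence "h x + \<theta> + Q - 1 \<noteq> 0" by (metis padic_norm_0 zero_neq_one)
  \<comment> \<open>The fixed point 1 lies on the excluded unit sphere.\<close>
  moreover have "h x \<noteq> 1" using ne1[OF x] by auto
  ultimately have root: "(h x)\<^sup>2 + (2 * \<theta> - \<theta>\<^sup>2 + 2 * Q - 1) * h x + Q\<^sup>2 = 0"
    by (rule potts_g_fixed_point_root[OF fp])
  \<comment> \<open>The fixed point equation also yields the norm that singles out
    \<open>potts_x1\<close> among the roots.\<close>
  have "padic_norm (h x) = padic_norm (potts_g \<theta> Q (h x)) * padic_norm (potts_g \<theta> Q (h x))"
    using arg_cong[OF fp, of padic_norm] by (simp only: padic_norm_mult)
  hence "padic_norm (h x) = (padic_norm Q)\<^sup>2"
    by (simp add: padic_norm_potts_g[OF \<theta> Q small[OF x]] power2_eq_square)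
  with root show "h x = potts_x1 \<theta> Q"
    using potts_x1_eqI[of \<theta> Q "h x"] \<theta> Q by simp
qed

end
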